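(* Let $(M,g)$ be a semi-Riemannian manifold and let $\phi$ be a non-trivial homothety of $(M,g)$. If the group $\langle\phi\rangle$ generated by $\phi$, acting on $M$, admits a strongly locally finite fundamental region, then $\phi$ is not essential.
   Context: Manifolds are smooth (Hausdorff, second countable). A diffeomorphism $\phi$ of a semi-Riemannian manifold $(M,g)$ is a conformal transformation if $\phi^*g=\mathrm{e}^{2f}g$ for some smooth function $f$ on $M$; it is a homothety if $f$ is constant; it is non-trivial if it is not an isometry of $(M,g)$. A conformal transformation $\phi$ is inessential if there is a metric $\hat g$ conformally equivalent to $g$ (i.e. $\hat g=\mathrm{e}^{2h}g$ for some smooth function $h:M\to\mathbb{R}$) for which $\phi$ is an isometry; otherwise $\phi$ is essential. Let a group $G$ act by homeomorphisms on a topological space $X$. Two sets meet if their intersection is non-empty. An open set $R\subset X$ is a fundamental region for the action if (i) whenever $\gamma R$ meets $R$ for $\gamma\in G$, then $\gamma$ is the identity, and (ii) $\bigcup_{\gamma\in G}\gamma\overline R=X$, where $\overline R$ is the closure of $R$. A family of sets $\{A_\gamma\}_{\gamma\in G}$ in $X$ is locally finite if every point of $X$ has an open neighbourhood that meets $A_\gamma$ for only finitely many $\gamma\in G$. A fundamental region $R$ is strongly locally finite if $\overline R$ has an open neighbourhood $U$ such that the family $\{\gamma U\}_{\gamma\in G}$ is locally finite. *)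

theory Defs
  imports "HOL-Analysis.Analysis" "HOL-Library.Function_Algebras"
    "HOL-Algebra.Bij" "HOL-Algebra.Elementary_Groups"
begin

section \<open>Smooth manifolds\<close>

primrec Ck_on :: "nat \<Rightarrow> 'a::real_normed_vector set \<Rightarrow> ('a \<Rightarrow> 'b::real_normed_vector) \<Rightarrow> bool" where
  "Ck_on 0 S f \<longleftrightarrow> continuous_on S f"
| "Ck_on (Suc k) S f \<longleftrightarrow> (\<forall>x\<in>S. f differentiable (at x)) \<and>
     (\<forall>v. Ck_on k S (\<lambda>x. frechet_derivative f (at x) v))"

text \<open>Only meant for open \<open>S\<close>; the values of \<open>f\<close> outside \<open>S\<close> are then irrelevant.\<close>

definition smooth_on :: "'a::real_normed_vector set \<Rightarrow> ('a \<Rightarrow> 'b::real_normed_vector) \<Rightarrow> bool" where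
  "smooth_on S f \<longleftrightarrow> (\<forall>k. Ck_on k S f)"

text \<open>The manifold is a whole Hausdorff second countable type \<open>'m\<close>, with an atlas \<open>A\<close> modelled on
  \<open>'e\<close>.  The atlas need not be maximal; every notion below depends only on the maximal atlas
  containing it.  A chart \<open>(U, x)\<close> is a total function \<open>x\<close> of which only the restriction to the
  domain \<open>U\<close> matters, and \<open>inv_into U x\<close> is its inverse.\<close>

type_synonym ('m, 'e) chart = "'m set \<times> ('m \<Rightarrow> 'e)"

definition is_chart :: "('m::topological_space, 'e::euclidean_space) chart \<Rightarrow> bool" where
  "is_chart = (\<lambda>(U, x). open U \<and> open (x ` U) \<and> homeomorphism U (x ` U) x (inv_into U x))"

definition smooth_atlas ::
    "('m::{t2_space, second_countable_topology}, 'e::euclidean_space) chart set \<Rightarrow> bool" where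
  "smooth_atlas A \<longleftrightarrow>
     (\<forall>c\<in>A. is_chart c) \<and>
     (\<Union>(U, x)\<in>A. U) = UNIV \<and>
     (\<forall>(U, x)\<in>A. \<forall>(V, y)\<in>A. smooth_on (x ` (U \<inter> V)) (y \<circ> inv_into U x))"

definition smooth_fun ::
    "('m::topological_space, 'e::euclidean_space) chart set \<Rightarrow> ('m \<Rightarrow> real) \<Rightarrow> bool" where
  "smooth_fun A f \<longleftrightarrow> (\<forall>(U, x)\<in>A. smooth_on (x ` U) (f \<circ> inv_into U x))"

definition smooth_map ::
    "('m::topological_space, 'e::euclidean_space) chart set \<Rightarrow> ('m \<Rightarrow> 'm) \<Rightarrow> bool" where
  "smooth_map A \<phi> \<longleftrightarrow> continuous_on UNIV \<phi> \<and>
     (\<forall>(U, x)\<in>A. \<forall>(V, y)\<in>A. smooth_on (x ` (U \<inter> \<phi> -` V)) (y \<circ> \<phi> \<circ> inv_into U x))"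

definition diffeomorphism ::
    "('m::topological_space, 'e::euclidean_space) chart set \<Rightarrow> ('m \<Rightarrow> 'm) \<Rightarrow> bool" where
  "diffeomorphism A \<phi> \<longleftrightarrow> bij \<phi> \<and> smooth_map A \<phi> \<and> smooth_map A (inv_into UNIV \<phi>)"

section \<open>Tangent vectors and vector fields\<close>

text \<open>Tangent vectors at \<open>p\<close> are derivations at \<open>p\<close> of the algebra of smooth functions.  As HOL
  functions are total, a derivation is made to vanish on the functions that are not smooth, so
  that equal derivations are equal as HOL functions.\<close>

type_synonym 'm tangent_vector = "('m \<Rightarrow> real) \<Rightarrow> real"

definition tangent_space ::
    "('m::topological_space, 'e::euclidean_space) chart set \<Rightarrow> 'm \<Rightarrow> 'm tangent_vector set" where
  "tangent_space A p = {v.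
     (\<forall>f h a b. smooth_fun A f \<longrightarrow> smooth_fun A h \<longrightarrow>
        v (\<lambda>q. a * f q + b * h q) = a * v f + b * v h) \<and>
     (\<forall>f h. smooth_fun A f \<longrightarrow> smooth_fun A h \<longrightarrow>
        v (\<lambda>q. f q * h q) = v f * h p + f p * v h) \<and>
     (\<forall>f. \<not> smooth_fun A f \<longrightarrow> v f = 0)}"

definition scale_tv :: "real \<Rightarrow> 'm tangent_vector \<Rightarrow> 'm tangent_vector" where
  "scale_tv a v = (\<lambda>f. a * v f)"

interpretation tangent: vector_space scale_tv
  by unfold_locales (auto simp: scale_tv_def fun_eq_iff algebra_simps)

definition pushforward ::
    "('m::topological_space, 'e::euclidean_space) chart set \<Rightarrow> ('m \<Rightarrow> 'm) \<Rightarrow>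
     'm tangent_vector \<Rightarrow> 'm tangent_vector" where
  "pushforward A \<phi> v = (\<lambda>f. if smooth_fun A f then v (f \<circ> \<phi>) else 0)"

definition smooth_vector_field ::
    "('m::topological_space, 'e::euclidean_space) chart set \<Rightarrow> ('m \<Rightarrow> 'm tangent_vector) \<Rightarrow> bool" where
  "smooth_vector_field A X \<longleftrightarrow> (\<forall>p. X p \<in> tangent_space A p) \<and>
     (\<forall>f. smooth_fun A f \<longrightarrow> smooth_fun A (\<lambda>p. X p f))"

section \<open>Semi-Riemannian metrics\<close>

type_synonym 'm metric = "'m \<Rightarrow> 'm tangent_vector \<Rightarrow> 'm tangent_vector \<Rightarrow> real"

text \<open>Only the values of \<open>b\<close> on the space \<open>T\<close> matter.\<close>

definition symmetric_bilinear_on ::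
    "'m tangent_vector set \<Rightarrow> ('m tangent_vector \<Rightarrow> 'm tangent_vector \<Rightarrow> real) \<Rightarrow> bool" where
  "symmetric_bilinear_on T b \<longleftrightarrow>
     (\<forall>v\<in>T. \<forall>w\<in>T. b v w = b w v) \<and>
     (\<forall>u\<in>T. \<forall>v\<in>T. \<forall>w\<in>T. \<forall>r s.
        b (scale_tv r u + scale_tv s v) w = r * b u w + s * b v w)"

definition nondegenerate_on ::
    "'m tangent_vector set \<Rightarrow> ('m tangent_vector \<Rightarrow> 'm tangent_vector \<Rightarrow> real) \<Rightarrow> bool" where
  "nondegenerate_on T b \<longleftrightarrow> (\<forall>v\<in>T. (\<forall>w\<in>T. b v w = 0) \<longrightarrow> v = 0)"

text \<open>The index of \<open>b\<close> on \<open>T\<close>: the largest dimension of a subspace of \<open>T\<close> on which \<open>b\<close> is negative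
  definite.  It is used for finite-dimensional \<open>T\<close>, where the maximum exists.\<close>

definition form_index ::
    "'m tangent_vector set \<Rightarrow> ('m tangent_vector \<Rightarrow> 'm tangent_vector \<Rightarrow> real) \<Rightarrow> nat" where
  "form_index T b = Max {tangent.dim W | W. tangent.subspace W \<and> W \<subseteq> T \<and>
     (\<forall>w\<in>W. w \<noteq> 0 \<longrightarrow> b w w < 0)}"

definition semi_riemannian_metric ::
    "('m::topological_space, 'e::euclidean_space) chart set \<Rightarrow> 'm metric \<Rightarrow> bool" where
  "semi_riemannian_metric A g \<longleftrightarrow>
     (\<forall>p. symmetric_bilinear_on (tangent_space A p) (g p)) \<and>
     (\<forall>p. nondegenerate_on (tangent_space A p) (g p)) \<and>
     (\<exists>k. \<forall>p. form_index (tangent_space A p) (g p) = k) \<and>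
     (\<forall>X Y. smooth_vector_field A X \<longrightarrow> smooth_vector_field A Y \<longrightarrow>
        smooth_fun A (\<lambda>p. g p (X p) (Y p)))"

definition pullback ::
    "('m::topological_space, 'e::euclidean_space) chart set \<Rightarrow> ('m \<Rightarrow> 'm) \<Rightarrow> 'm metric \<Rightarrow> 'm metric" where
  "pullback A \<phi> g = (\<lambda>p v w. g (\<phi> p) (pushforward A \<phi> v) (pushforward A \<phi> w))"

text \<open>Equality of tensor fields: agreement on all tangent vectors.\<close>

definition eq_metric ::
    "('m::topological_space, 'e::euclidean_space) chart set \<Rightarrow> 'm metric \<Rightarrow> 'm metric \<Rightarrow> bool" where
  "eq_metric A g g' \<longleftrightarrow>
     (\<forall>p. \<forall>v\<in>tangent_space A p. \<forall>w\<in>tangent_space A p. g p v w = g' p v w)"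

definition rescale :: "('m \<Rightarrow> real) \<Rightarrow> 'm metric \<Rightarrow> 'm metric" where
  "rescale f g = (\<lambda>p v w. exp (2 * f p) * g p v w)"

definition conformally_equivalent ::
    "('m::topological_space, 'e::euclidean_space) chart set \<Rightarrow> 'm metric \<Rightarrow> 'm metric \<Rightarrow> bool" where
  "conformally_equivalent A g g' \<longleftrightarrow> (\<exists>h. smooth_fun A h \<and> eq_metric A g' (rescale h g))"

section \<open>Conformal transformations\<close>

definition isometry ::
    "('m::topological_space, 'e::euclidean_space) chart set \<Rightarrow> 'm metric \<Rightarrow> ('m \<Rightarrow> 'm) \<Rightarrow> bool" where
  "isometry A g \<phi> \<longleftrightarrow> diffeomorphism A \<phi> \<and> eq_metric A (pullback A \<phi> g) g"

definition conformal_transformation ::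
    "('m::topological_space, 'e::euclidean_space) chart set \<Rightarrow> 'm metric \<Rightarrow> ('m \<Rightarrow> 'm) \<Rightarrow> bool" where
  "conformal_transformation A g \<phi> \<longleftrightarrow> diffeomorphism A \<phi> \<and>
     (\<exists>f. smooth_fun A f \<and> eq_metric A (pullback A \<phi> g) (rescale f g))"

definition homothety ::
    "('m::topological_space, 'e::euclidean_space) chart set \<Rightarrow> 'm metric \<Rightarrow> ('m \<Rightarrow> 'm) \<Rightarrow> bool" where
  "homothety A g \<phi> \<longleftrightarrow> diffeomorphism A \<phi> \<and>
     (\<exists>f. smooth_fun A f \<and> f constant_on UNIV \<and> eq_metric A (pullback A \<phi> g) (rescale f g))"

definition inessential ::
    "('m::topological_space, 'e::euclidean_space) chart set \<Rightarrow> 'm metric \<Rightarrow> ('m \<Rightarrow> 'm) \<Rightarrow> bool" where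
  "inessential A g \<phi> \<longleftrightarrow> conformal_transformation A g \<phi> \<and>
     (\<exists>g'. semi_riemannian_metric A g' \<and> conformally_equivalent A g g' \<and> isometry A g' \<phi>)"

definition essential ::
    "('m::topological_space, 'e::euclidean_space) chart set \<Rightarrow> 'm metric \<Rightarrow> ('m \<Rightarrow> 'm) \<Rightarrow> bool" where
  "essential A g \<phi> \<longleftrightarrow> conformal_transformation A g \<phi> \<and> \<not> inessential A g \<phi>"

section \<open>Fundamental regions\<close>

definition fundamental_region ::
    "('g, 'c) monoid_scheme \<Rightarrow> ('g \<Rightarrow> 'x \<Rightarrow> 'x) \<Rightarrow> 'x::topological_space set \<Rightarrow> bool" where
  "fundamental_region G act R \<longleftrightarrow> open R \<and>
     (\<forall>\<gamma>\<in>carrier G. act \<gamma> ` R \<inter> R \<noteq> {} \<longrightarrow> \<gamma> = \<one>\<^bsub>G\<^esub>) \<and>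
     (\<Union>\<gamma>\<in>carrier G. act \<gamma> ` closure R) = UNIV"

text \<open>Unlike \<^const>\<open>locally_finite_in\<close>, this is about indexed families: repetitions count.\<close>

definition locally_finite_family :: "'i set \<Rightarrow> ('i \<Rightarrow> 'x::topological_space set) \<Rightarrow> bool" where
  "locally_finite_family I S \<longleftrightarrow>
     (\<forall>x. \<exists>W. open W \<and> x \<in> W \<and> finite {i\<in>I. W \<inter> S i \<noteq> {}})"

definition strongly_locally_finite_region ::
    "('g, 'c) monoid_scheme \<Rightarrow> ('g \<Rightarrow> 'x \<Rightarrow> 'x) \<Rightarrow> 'x::topological_space set \<Rightarrow> bool" where
  "strongly_locally_finite_region G act R \<longleftrightarrow> fundamental_region G act R \<and>
     (\<exists>U. open U \<and> closure R \<subseteq> U \<and> locally_finite_family (carrier G) (\<lambda>\<gamma>. act \<gamma> ` U))"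

text \<open>The group generated by a bijection \<open>\<phi>\<close>; it acts by evaluation.\<close>

definition cyclic_group_of :: "('m \<Rightarrow> 'm) \<Rightarrow> ('m \<Rightarrow> 'm) monoid" where
  "cyclic_group_of \<phi> = subgroup_generated (BijGroup UNIV) {\<phi>}"

end

theory Submission
  imports Defs
begin

text \<open>Let \<open>\<phi>\<close> pull \<open>g\<close> back to \<open>e\<^sup>2\<^sup>c g\<close>. For a conformal change \<open>u g\<close> with a positive function
  \<open>u\<close> to be preserved by \<open>\<phi>\<close> one needs exactly \<open>u \<circ> \<phi> = e\<^sup>-\<^sup>2\<^sup>c u\<close>, so the task is to find a
  smooth positive function that transforms by a given character of the group.

  Every element \<open>\<gamma>\<close> of the group \<open>G\<close> generated by \<open>\<phi>\<close> multiplies \<open>g\<close> by a positive constant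
  \<open>a \<gamma>\<close>. As \<open>\<phi>\<close> is not an isometry, \<open>g\<close> does not vanish identically; so \<open>a \<gamma>\<close> is unique, and
  \<open>a\<close> is a homomorphism. Let \<open>R\<close> be the region and \<open>U\<close> a neighbourhood of its closure with locally
  finite translates. Take a smooth \<open>\<psi> \<ge> 0\<close> that is positive on the closure of \<open>R\<close> and
  vanishes outside \<open>U\<close> (\<open>smooth_support_function\<close>). Then the sum of \<open>(\<psi> \<circ> \<gamma>\<^sup>-\<^sup>1) / a \<gamma>\<close> over
  \<open>\<gamma> \<in> G\<close> is locally finite, hence smooth; it is positive because the translates of the closure of
  \<open>R\<close> cover the manifold; and it transforms as required, because composition with \<open>\<phi>\<close> permutes
  its terms up to the factor \<open>1 / a \<phi>\<close> (\<open>smooth_equivariant_function\<close>). With \<open>h = ln u / 2\<close> the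
  metric \<open>e\<^sup>2\<^sup>h g\<close> is then preserved by \<open>\<phi>\<close>. Indexing the sum by the group rather than by the powers
  of \<open>\<phi>\<close> avoids any discussion of the order of \<open>\<phi>\<close>.\<close>

section \<open>Calculus of smooth functions\<close>

lemma Ck_on_cong:
  assumes "open S" and "\<And>x. x \<in> S \<Longrightarrow> f x = g x" and "Ck_on k S f"
  shows "Ck_on k S g"
  using assms(2,3)
proof (induction k arbitrary: f g)
  case 0
  then show ?case by (simp cong: continuous_on_cong)
next
  case (Suc k)
  have D: "(g has_derivative frechet_derivative f (at x)) (at x)" if "x \<in> S" for x
    using Suc.prems that \<open>open S\<close>
    by (metis Ck_on.simps(2) frechet_derivative_works has_derivative_transform_within_open)
  then have eq: "frechet_derivative f (at x) = frechet_derivative g (at x)" if "x \<in> S" for x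
    using that frechet_derivative_at by blast
  have "Ck_on k S (\<lambda>x. frechet_derivative g (at x) v)" for v
    using Suc.IH[of "\<lambda>x. frechet_derivative f (at x) v"] Suc.prems eq by auto
  then show ?case
    using D by (auto simp: differentiable_def)
qed

lemma Ck_on_SucI:
  assumes "open S" and "\<And>x. x \<in> S \<Longrightarrow> (f has_derivative f' x) (at x)"
    and "\<And>v. Ck_on k S (\<lambda>x. f' x v)"
  shows "Ck_on (Suc k) S f"
proof -
  have "frechet_derivative f (at x) = f' x" if "x \<in> S" for x
    using assms(2)[OF that] frechet_derivative_at by metis
  then have "Ck_on k S (\<lambda>x. frechet_derivative f (at x) v)" for v
    using Ck_on_cong[OF assms(1) _ assms(3)[of v]] by simp
  then show ?thesis
    using assms(2) by (auto simp: differentiable_def)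
qed

lemma Ck_on_SucD:
  assumes "Ck_on (Suc k) S f"
  shows "x \<in> S \<Longrightarrow> (f has_derivative frechet_derivative f (at x)) (at x)"
    and "Ck_on k S (\<lambda>x. frechet_derivative f (at x) v)"
  using assms by (auto simp: frechet_derivative_works)

lemma Ck_on_Suc_imp: "Ck_on (Suc k) S f \<Longrightarrow> Ck_on k S f"
proof (induction k arbitrary: f)
  case 0
  then show ?case
    by (auto intro!: continuous_at_imp_continuous_on differentiable_imp_continuous_within)
qed auto

lemma Ck_on_subset: "Ck_on k S f \<Longrightarrow> T \<subseteq> S \<Longrightarrow> Ck_on k T f"
  by (induction k arbitrary: f) (auto intro: continuous_on_subset)

lemma Ck_on_local:
  assumes "\<And>x. x \<in> S \<Longrightarrow> \<exists>T. open T \<and> x \<in> T \<and> Ck_on k T f"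
  shows "Ck_on k S f"
  using assms
proof (induction k arbitrary: f)
  case 0
  then have "\<forall>x\<in>S. isCont f x"
    by (metis Ck_on.simps(1) continuous_on_eq_continuous_at)
  then show ?case
    by (simp add: continuous_at_imp_continuous_on)
next
  case (Suc k)
  have "f differentiable (at x)" if "x \<in> S" for x
    using Suc.prems[OF that] by auto
  moreover have "Ck_on k S (\<lambda>x. frechet_derivative f (at x) v)" for v
  proof (rule Suc.IH)
    fix x assume "x \<in> S"
    from Suc.prems[OF this]
    show "\<exists>T. open T \<and> x \<in> T \<and> Ck_on k T (\<lambda>x. frechet_derivative f (at x) v)" by auto
  qed
  ultimately show ?case by simp
qed

lemma Ck_on_const: "Ck_on k S (\<lambda>x. c)"
proof (induction k arbitrary: c)
  case (Suc k)
  then show ?case by simp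
qed simp

lemma Ck_on_bounded_linear:
  assumes "bounded_linear L" "open S"
  shows "Ck_on k S L"
proof (cases k)
  case 0
  then show ?thesis using assms by (simp add: linear_continuous_on)
next
  case (Suc n)
  show ?thesis unfolding Suc
    by (rule Ck_on_SucI[where f' = "\<lambda>_. L"])
      (use assms in \<open>auto intro: Ck_on_const bounded_linear_imp_has_derivative\<close>)
qed

lemma Ck_on_add:
  assumes "open S" "Ck_on k S f" "Ck_on k S g"
  shows "Ck_on k S (\<lambda>x. f x + g x)"
  using assms(2,3)
proof (induction k arbitrary: f g)
  case 0
  then show ?case by (simp add: continuous_on_add)
next
  case (Suc k)
  show ?case
    by (rule Ck_on_SucI[where f' = "\<lambda>x v. frechet_derivative f (at x) v + frechet_derivative g (at x) v",
            OF assms(1)])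
      (intro has_derivative_add Suc.IH Ck_on_SucD[OF Suc.prems(1)] Ck_on_SucD[OF Suc.prems(2)];
        assumption)+
qed

lemma Ck_on_sum:
  assumes "open S" "finite I" "\<And>i. i \<in> I \<Longrightarrow> Ck_on k S (f i)"
  shows "Ck_on k S (\<lambda>x. \<Sum>i\<in>I. f i x)"
  using assms(2,3)
  by (induction I rule: finite_induct) (auto intro: Ck_on_const Ck_on_add[OF assms(1)])

lemma Ck_on_bilinear:
  assumes "bounded_bilinear B" "open S" "Ck_on k S f" "Ck_on k S g"
  shows "Ck_on k S (\<lambda>x. B (f x) (g x))"
  using assms(3,4)
proof (induction k arbitrary: f g)
  case 0
  then show ?case by (simp add: bounded_bilinear.continuous_on[OF assms(1)])
next
  case (Suc k)
  show ?case
    by (rule Ck_on_SucI[where f' = "\<lambda>x v. B (f x) (frechet_derivative g (at x) v)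
              + B (frechet_derivative f (at x) v) (g x)", OF assms(2)])
      (intro bounded_bilinear.FDERIV[OF assms(1)] Ck_on_add assms(2) Suc.IH
         Ck_on_SucD[OF Suc.prems(1)] Ck_on_SucD[OF Suc.prems(2)]
         Ck_on_Suc_imp[OF Suc.prems(1)] Ck_on_Suc_imp[OF Suc.prems(2)]; assumption)+
qed

text \<open>By the chain rule the derivative of \<open>g \<circ> f\<close> is a value of \<open>Dg\<close> in a direction that itself
  varies with the point. Expanding this direction in a basis leaves only derivatives of \<open>g\<close> in
  constant directions, to which the induction hypothesis applies.\<close>

lemma Ck_on_compose:
  fixes f :: "'a::real_normed_vector \<Rightarrow> 'b::euclidean_space"
    and g :: "'b \<Rightarrow> 'c::real_normed_vector"
  assumes "open S" "open T" "f ` S \<subseteq> T" "Ck_on k S f" "Ck_on k T g"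
  shows "Ck_on k S (\<lambda>x. g (f x))"
  using assms(4,5)
proof (induction k arbitrary: g)
  case 0
  then show ?case using assms(3) by (auto intro: continuous_on_compose2)
next
  case (Suc k)
  let ?f' = "\<lambda>x. frechet_derivative f (at x)"
  let ?g' = "\<lambda>y. frechet_derivative g (at y)"
  show ?case
  proof (rule Ck_on_SucI[where f' = "\<lambda>x v. \<Sum>i\<in>Basis. (?f' x v \<bullet> i) *\<^sub>R ?g' (f x) i", OF assms(1)])
    fix x assume x: "x \<in> S"
    then have fx: "f x \<in> T" using assms(3) by auto
    have g': "(g has_derivative ?g' (f x)) (at (f x))"
      using Ck_on_SucD(1)[OF Suc.prems(2) fx] .
    have "linear (?g' (f x))"
      using g' has_derivative_linear by blast
    then have *: "?g' (f x) w = (\<Sum>i\<in>Basis. (w \<bullet> i) *\<^sub>R ?g' (f x) i)" for w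
      by (subst (1) euclidean_representation[of w, symmetric])
        (simp add: linear_sum linear_scale)
    show "((\<lambda>x. g (f x)) has_derivative (\<lambda>v. \<Sum>i\<in>Basis. (?f' x v \<bullet> i) *\<^sub>R ?g' (f x) i)) (at x)"
      using has_derivative_compose[OF Ck_on_SucD(1)[OF Suc.prems(1) x] g'] by (subst (asm) *)
  next
    fix v
    have "Ck_on k S (\<lambda>x. ?f' x v \<bullet> i)" for i
      by (intro Ck_on_bilinear[OF bounded_bilinear_inner] assms(1) Ck_on_const
          Ck_on_SucD(2)[OF Suc.prems(1)])
    moreover have "Ck_on k S (\<lambda>x. ?g' (f x) i)" for i
      by (intro Suc.IH Ck_on_Suc_imp[OF Suc.prems(1)] Ck_on_SucD(2)[OF Suc.prems(2)])
    ultimately show "Ck_on k S (\<lambda>x. \<Sum>i\<in>Basis. (?f' x v \<bullet> i) *\<^sub>R ?g' (f x) i)"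
      by (intro Ck_on_sum Ck_on_bilinear[OF bounded_bilinear_scaleR] assms(1) finite_Basis)
  qed
qed

lemma smooth_on_cong:
  "open S \<Longrightarrow> (\<And>x. x \<in> S \<Longrightarrow> f x = g x) \<Longrightarrow> smooth_on S f \<Longrightarrow> smooth_on S g"
  unfolding smooth_on_def using Ck_on_cong by blast

lemma smooth_on_subset: "smooth_on S f \<Longrightarrow> T \<subseteq> S \<Longrightarrow> smooth_on T f"
  unfolding smooth_on_def using Ck_on_subset by blast

lemma smooth_on_local:
  "(\<And>x. x \<in> S \<Longrightarrow> \<exists>T. open T \<and> x \<in> T \<and> smooth_on T f) \<Longrightarrow> smooth_on S f"
  unfolding smooth_on_def by (metis Ck_on_local)

lemma smooth_on_const: "smooth_on S (\<lambda>x. c)"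
  by (simp add: smooth_on_def Ck_on_const)

lemma smooth_on_ident: "open S \<Longrightarrow> smooth_on S (\<lambda>x. x)"
  by (simp add: smooth_on_def Ck_on_bounded_linear)

lemma smooth_on_add:
  "open S \<Longrightarrow> smooth_on S f \<Longrightarrow> smooth_on S g \<Longrightarrow> smooth_on S (\<lambda>x. f x + g x)"
  by (simp add: smooth_on_def Ck_on_add)

lemma smooth_on_bilinear:
  "bounded_bilinear B \<Longrightarrow> open S \<Longrightarrow> smooth_on S f \<Longrightarrow> smooth_on S g \<Longrightarrow>
    smooth_on S (\<lambda>x. B (f x) (g x))"
  by (simp add: smooth_on_def Ck_on_bilinear)

lemmas smooth_on_mult = smooth_on_bilinear[OF bounded_bilinear_mult]
lemmas smooth_on_inner = smooth_on_bilinear[OF bounded_bilinear_inner]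

lemma smooth_on_compose:
  fixes f :: "'a::real_normed_vector \<Rightarrow> 'b::euclidean_space"
  shows "open S \<Longrightarrow> open T \<Longrightarrow> f ` S \<subseteq> T \<Longrightarrow> smooth_on S f \<Longrightarrow> smooth_on T g \<Longrightarrow>
    smooth_on S (\<lambda>x. g (f x))"
  unfolding smooth_on_def using Ck_on_compose by blast

lemma smooth_on_inverse: "smooth_on {0<..} (inverse :: real \<Rightarrow> real)"
proof -
  have "Ck_on k {0<..} (inverse :: real \<Rightarrow> real)" for k
  proof (induction k)
    case 0
    show ?case by (auto intro!: continuous_intros)
  next
    case (Suc k)
    show ?case
    proof (rule Ck_on_SucI[where f' = "\<lambda>x v. - v * (inverse x * inverse x)"])
      show "Ck_on k {0<..} (\<lambda>x::real. - v * (inverse x * inverse x))" for v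
        by (intro Ck_on_bilinear[OF bounded_bilinear_mult] Suc.IH Ck_on_const) auto
    qed (auto intro!: derivative_eq_intros)
  qed
  then show ?thesis by (simp add: smooth_on_def)
qed

lemma smooth_on_ln: "smooth_on {0<..} (ln :: real \<Rightarrow> real)"
proof -
  have "Ck_on k {0<..} (ln :: real \<Rightarrow> real)" for k
  proof (cases k)
    case 0
    then show ?thesis by (auto intro!: continuous_intros)
  next
    case (Suc n)
    show ?thesis unfolding Suc
    proof (rule Ck_on_SucI[where f' = "\<lambda>x v. v * inverse x"])
      show "Ck_on n {0<..} (\<lambda>x::real. v * inverse x)" for v
        using smooth_on_inverse
        by (intro Ck_on_bilinear[OF bounded_bilinear_mult] Ck_on_const) (auto simp: smooth_on_def)
    qed (auto intro!: derivative_eq_intros simp: field_simps)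
  qed
  then show ?thesis by (simp add: smooth_on_def)
qed

lemma smooth_on_exp: "smooth_on UNIV (exp :: real \<Rightarrow> real)"
proof -
  have "Ck_on k UNIV (exp :: real \<Rightarrow> real)" for k
  proof (induction k)
    case 0
    show ?case by (auto intro!: continuous_intros)
  next
    case (Suc k)
    show ?case
    proof (rule Ck_on_SucI[where f' = "\<lambda>x v. v * exp x"])
      show "Ck_on k UNIV (\<lambda>x::real. v * exp x)" for v
        by (intro Ck_on_bilinear[OF bounded_bilinear_mult] Suc.IH Ck_on_const) auto
    qed (auto intro!: derivative_eq_intros)
  qed
  then show ?thesis by (simp add: smooth_on_def)
qed

text \<open>The functions \<open>t\<^sup>-\<^sup>n e\<^sup>-\<^sup>1\<^sup>/\<^sup>t\<close>, extended by \<open>0\<close> to the left. Bumps are built from \<open>flat 0\<close>;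
  the exponent \<open>n\<close> makes the family closed under differentiation up to linear combinations, so that
  its smoothness follows by induction.\<close>

definition flat :: "nat \<Rightarrow> real \<Rightarrow> real" where
  "flat n t = (if 0 < t then exp (- inverse t) * inverse t ^ n else 0)"

lemma flat_nonneg: "0 \<le> flat n t"
  by (simp add: flat_def)

lemma flat_pos_iff: "0 < flat n t \<longleftrightarrow> 0 < t"
  by (simp add: flat_def)

lemma flat_tendsto_0: "(flat n \<longlongrightarrow> 0) (at 0)"
proof (rule filterlim_split_at)
  show "(flat n \<longlongrightarrow> 0) (at_left 0)"
    by (rule tendsto_eventually) (auto simp: eventually_at_filter flat_def)
  have "((\<lambda>s::real. s ^ n / exp s) \<longlongrightarrow> 0) at_top"
    by (rule tendsto_power_div_exp_0)
  then have "((\<lambda>t::real. inverse t ^ n / exp (inverse t)) \<longlongrightarrow> 0) (at_right 0)"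
    by (rule filterlim_compose) (rule filterlim_inverse_at_top_right)
  then show "(flat n \<longlongrightarrow> 0) (at_right 0)"
    by (rule Lim_transform_eventually)
      (auto simp: eventually_at_filter flat_def exp_minus divide_inverse)
qed

lemma flat_has_real_derivative:
  "(flat n has_real_derivative flat (n + 2) t - real n * flat (n + 1) t) (at t)"
proof (cases t "0::real" rule: linorder_cases)
  case less
  have "((\<lambda>_. 0) has_real_derivative 0) (at t)" by simp
  then have "(flat n has_real_derivative 0) (at t)"
    by (rule has_field_derivative_transform_within_open[where S = "{..<0}"])
      (use less in \<open>auto simp: flat_def\<close>)
  then show ?thesis using less by (simp add: flat_def)
next
  case equal
  have "flat n h / h = flat (n + 1) h" for h
    by (simp add: flat_def field_simps)
  then show ?thesis
    using flat_tendsto_0[of "n + 1"] by (simp add: equal DERIV_def flat_def[of _ 0])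
next
  case greater
  have "((\<lambda>t. exp (- inverse t) * inverse t ^ n) has_real_derivative
      flat (n + 2) t - real n * flat (n + 1) t) (at t)"
    using greater
    by (auto intro!: derivative_eq_intros simp: flat_def)
      (cases n; simp add: field_simps power2_eq_square)
  then show ?thesis
    by (rule has_field_derivative_transform_within_open[where S = "{0<..}"])
      (use greater in \<open>auto simp: flat_def\<close>)
qed

lemma smooth_on_flat: "smooth_on UNIV (flat n)"
proof -
  have "Ck_on k UNIV (flat n)" for k n
  proof (induction k arbitrary: n)
    case 0
    show ?case
      by (simp add: continuous_at_imp_continuous_on DERIV_isCont[OF flat_has_real_derivative])
  next
    case (Suc k)
    show ?case
    proof (rule Ck_on_SucI)
      show "(flat n has_derivative (*) (flat (n + 2) t + - real n * flat (n + 1) t)) (at t)" for t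
        using flat_has_real_derivative[of n t] by (simp add: has_field_derivative_def)
      show "Ck_on k UNIV (\<lambda>t. (flat (n + 2) t + - real n * flat (n + 1) t) * v)" for v
        by (intro Ck_on_bilinear[OF bounded_bilinear_mult] Ck_on_add Ck_on_const Suc.IH open_UNIV)
    qed simp
  qed
  then show ?thesis by (simp add: smooth_on_def)
qed


section \<open>Smooth functions on a manifold\<close>

lemma smooth_atlasD:
  assumes "smooth_atlas A"
  shows "(U, x) \<in> A \<Longrightarrow> is_chart (U, x)"
    and "(U, x) \<in> A \<Longrightarrow> (V, y) \<in> A \<Longrightarrow> smooth_on (x ` (U \<inter> V)) (y \<circ> inv_into U x)"
  using assms by (auto simp: smooth_atlas_def split: prod.splits)

lemma chart_at:
  assumes "smooth_atlas A"
  obtains U x where "(U, x) \<in> A" "p \<in> U"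
proof -
  have "p \<in> (\<Union>(U, x)\<in>A. U)"
    using assms unfolding smooth_atlas_def by blast
  then show ?thesis using that by auto
qed

lemma is_chartD:
  assumes "is_chart (U, x)"
  shows "open U" and "inj_on x U" and "continuous_on U x"
    and "continuous_on (x ` U) (inv_into U x)"
    and "p \<in> U \<Longrightarrow> inv_into U x (x p) = p"
    and "open W \<Longrightarrow> open (x ` (U \<inter> W))"
proof -
  have U: "open U" "open (x ` U)" and h: "homeomorphism U (x ` U) x (inv_into U x)"
    using assms by (auto simp: is_chart_def)
  show "open U" "continuous_on U x" "continuous_on (x ` U) (inv_into U x)"
    using U h by (auto simp: homeomorphism_def)
  show inv: "p \<in> U \<Longrightarrow> inv_into U x (x p) = p" for p
    using h by (auto simp: homeomorphism_def)
  then show "inj_on x U"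
    by (rule inj_on_inverseI)
  assume "open W"
  then have "openin (top_of_set (x ` U)) (x ` (U \<inter> W))"
    by (intro homeomorphism_imp_open_map[OF h]) (auto simp: openin_open)
  then show "open (x ` (U \<inter> W))"
    using U(2) openin_open_trans by blast
qed

lemma smooth_funD:
  "smooth_fun A f \<Longrightarrow> (U, x) \<in> A \<Longrightarrow> smooth_on (x ` U) (f \<circ> inv_into U x)"
  by (auto simp: smooth_fun_def)

lemma smooth_fun_local:
  assumes A: "smooth_atlas A"
    and loc: "\<And>p. \<exists>W. open W \<and> p \<in> W \<and>
      (\<forall>(U, x)\<in>A. smooth_on (x ` (U \<inter> W)) (f \<circ> inv_into U x))"
  shows "smooth_fun A f"
  unfolding smooth_fun_def
proof (clarify, rule smooth_on_local)
  fix U x z assume c: "(U, x) \<in> A" and "z \<in> x ` U"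
  then obtain p where p: "p \<in> U" "z = x p" by auto
  obtain W where W: "open W" "p \<in> W" "smooth_on (x ` (U \<inter> W)) (f \<circ> inv_into U x)"
    using loc[of p] c by auto
  then show "\<exists>T. open T \<and> z \<in> T \<and> smooth_on T (f \<circ> inv_into U x)"
    using is_chartD(6)[OF smooth_atlasD(1)[OF A c]] p by (intro exI[of _ "x ` (U \<inter> W)"]) auto
qed

lemma smooth_fun_locally_eq:
  assumes A: "smooth_atlas A"
    and loc: "\<And>p. \<exists>W h. open W \<and> p \<in> W \<and> smooth_fun A h \<and> (\<forall>q\<in>W. h q = f q)"
  shows "smooth_fun A f"
proof (rule smooth_fun_local[OF A])
  fix p
  obtain W h where W: "open W" "p \<in> W" "smooth_fun A h" "\<And>q. q \<in> W \<Longrightarrow> h q = f q"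
    using loc[of p] by (elim exE conjE) simp
  have "smooth_on (x ` (U \<inter> W)) (f \<circ> inv_into U x)" if c: "(U, x) \<in> A" for U x
  proof (rule smooth_on_cong)
    show "smooth_on (x ` (U \<inter> W)) (h \<circ> inv_into U x)"
      using smooth_funD[OF W(3) c] by (rule smooth_on_subset) auto
  qed (use is_chartD[OF smooth_atlasD(1)[OF A c]] W in auto)
  then show "\<exists>W. open W \<and> p \<in> W \<and> (\<forall>(U, x)\<in>A. smooth_on (x ` (U \<inter> W)) (f \<circ> inv_into U x))"
    using W by auto
qed

lemma smooth_fun_const: "smooth_fun A (\<lambda>p. c)"
  by (auto simp: smooth_fun_def comp_def smooth_on_const)

lemma open_chart_image: "smooth_atlas A \<Longrightarrow> (U, x) \<in> A \<Longrightarrow> open (x ` U)"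
  using smooth_atlasD(1) by (fastforce simp: is_chart_def)

lemma smooth_fun_add:
  assumes "smooth_atlas A" "smooth_fun A f" "smooth_fun A h"
  shows "smooth_fun A (\<lambda>p. f p + h p)"
  using assms by (auto simp: smooth_fun_def comp_def intro!: smooth_on_add intro: open_chart_image)

lemma smooth_fun_mult:
  assumes "smooth_atlas A" "smooth_fun A f" "smooth_fun A h"
  shows "smooth_fun A (\<lambda>p. f p * h p)"
  using assms by (auto simp: smooth_fun_def comp_def intro!: smooth_on_mult intro: open_chart_image)

lemma smooth_fun_sum:
  assumes "smooth_atlas A" "\<And>i. i \<in> I \<Longrightarrow> smooth_fun A (f i)"
  shows "smooth_fun A (\<lambda>p. \<Sum>i\<in>I. f i p)"
  using assms(2)
  by (induction I rule: infinite_finite_induct) (auto intro: smooth_fun_const smooth_fun_add[OF assms(1)])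

lemma smooth_fun_prod:
  assumes "smooth_atlas A" "\<And>i. i \<in> I \<Longrightarrow> smooth_fun A (f i)"
  shows "smooth_fun A (\<lambda>p. \<Prod>i\<in>I. f i p)"
  using assms(2)
  by (induction I rule: infinite_finite_induct) (auto intro: smooth_fun_const smooth_fun_mult[OF assms(1)])

lemma smooth_fun_compose_real:
  fixes \<beta> :: "real \<Rightarrow> real"
  assumes "smooth_atlas A" "smooth_fun A f" "open T" "range f \<subseteq> T" "smooth_on T \<beta>"
  shows "smooth_fun A (\<lambda>p. \<beta> (f p))"
proof -
  have "smooth_on (x ` U) (\<lambda>z. \<beta> ((f \<circ> inv_into U x) z))" if c: "(U, x) \<in> A" for U x
    by (rule smooth_on_compose[OF open_chart_image[OF assms(1) c] assms(3) _ smooth_funD[OF assms(2) c] assms(5)])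
      (use assms(4) in auto)
  then show ?thesis by (auto simp: smooth_fun_def comp_def)
qed

lemma smooth_fun_continuous:
  assumes A: "smooth_atlas A" and f: "smooth_fun A f"
  shows "continuous_on UNIV f"
proof -
  have "isCont f p" for p
  proof -
    obtain U x where c: "(U, x) \<in> A" and p: "p \<in> U"
      using chart_at[OF A] by blast
    note ch = is_chartD[OF smooth_atlasD(1)[OF A c]]
    have "Ck_on 0 (x ` U) (f \<circ> inv_into U x)"
      using smooth_funD[OF f c] unfolding smooth_on_def by blast
    then have "continuous_on U ((f \<circ> inv_into U x) \<circ> x)"
      by (intro continuous_on_compose[OF ch(3)]) simp
    then have "continuous_on U f"
      by (rule continuous_on_eq) (simp add: ch)
    then show ?thesis
      using ch(1) p continuous_on_eq_continuous_at by blast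
  qed
  then show ?thesis by (simp add: continuous_at_imp_continuous_on)
qed

lemma smooth_fun_compose_map:
  assumes A: "smooth_atlas A" and f: "smooth_fun A f" and \<phi>: "smooth_map A \<phi>"
  shows "smooth_fun A (f \<circ> \<phi>)"
proof (rule smooth_fun_local[OF A])
  fix p
  obtain V y where d: "(V, y) \<in> A" and V: "\<phi> p \<in> V"
    using chart_at[OF A] by blast
  note chV = is_chartD[OF smooth_atlasD(1)[OF A d]]
  let ?W = "\<phi> -` V"
  have W: "open ?W"
    using \<phi> chV(1) by (auto simp: smooth_map_def continuous_on_open_vimage)
  have "smooth_on (x ` (U \<inter> ?W)) ((f \<circ> \<phi>) \<circ> inv_into U x)" if c: "(U, x) \<in> A" for U x
  proof -
    note chU = is_chartD[OF smooth_atlasD(1)[OF A c]]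
    have "smooth_on (x ` (U \<inter> ?W)) (\<lambda>z. (f \<circ> inv_into V y) ((y \<circ> \<phi> \<circ> inv_into U x) z))"
    proof (rule smooth_on_compose[OF chU(6)[OF W] open_chart_image[OF A d] _ _ smooth_funD[OF f d]])
      show "smooth_on (x ` (U \<inter> ?W)) (y \<circ> \<phi> \<circ> inv_into U x)"
        using \<phi> c d by (auto simp: smooth_map_def)
    qed (auto simp: chU)
    then show ?thesis
      by (rule smooth_on_cong[OF chU(6)[OF W], rotated]) (auto simp: chU chV)
  qed
  then show "\<exists>W. open W \<and> p \<in> W \<and> (\<forall>(U, x)\<in>A. smooth_on (x ` (U \<inter> W)) ((f \<circ> \<phi>) \<circ> inv_into U x))"
    using W V by (intro exI[of _ ?W]) auto
qed

text \<open>The sum runs over the indices with a nonzero term because a sum over an infinite set has the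
  default value \<open>0\<close>. Near every point it agrees with one fixed finite sum.\<close>

lemma smooth_fun_locally_finite_sum:
  assumes A: "smooth_atlas A" and f: "\<And>i. i \<in> I \<Longrightarrow> smooth_fun A (f i)"
    and fin: "locally_finite_family I (\<lambda>i. {p. f i p \<noteq> 0})"
  shows "smooth_fun A (\<lambda>p. \<Sum>i | i \<in> I \<and> f i p \<noteq> 0. f i p)"
proof (rule smooth_fun_locally_eq[OF A])
  fix p
  obtain W where W: "open W" "p \<in> W" "finite {i\<in>I. W \<inter> {p. f i p \<noteq> 0} \<noteq> {}}" (is "finite ?J")
    using fin unfolding locally_finite_family_def by blast
  have "(\<Sum>i\<in>?J. f i q) = (\<Sum>i | i \<in> I \<and> f i q \<noteq> 0. f i q)" if "q \<in> W" for q
    by (rule sum.mono_neutral_right) (use W that in auto)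
  then show "\<exists>W h. open W \<and> p \<in> W \<and> smooth_fun A h \<and>
      (\<forall>q\<in>W. h q = (\<Sum>i | i \<in> I \<and> f i q \<noteq> 0. f i q))"
    using W(1,2) f by (intro exI[of _ W] exI[of _ "\<lambda>q. \<Sum>i\<in>?J. f i q"])
      (auto intro!: smooth_fun_sum[OF A])
qed

lemma locally_finite_family_mono:
  assumes "locally_finite_family I S" "J \<subseteq> I" "\<And>i. i \<in> J \<Longrightarrow> T i \<subseteq> S i"
  shows "locally_finite_family J T"
  unfolding locally_finite_family_def
proof
  fix p
  obtain W where W: "open W" "p \<in> W" "finite {i\<in>I. W \<inter> S i \<noteq> {}}"
    using assms(1) unfolding locally_finite_family_def by blast
  have "finite {i\<in>J. W \<inter> T i \<noteq> {}}"
    by (rule finite_subset[OF _ W(3)]) (use assms(2) in \<open>auto dest: assms(3)[THEN subsetD]\<close>)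
  then show "\<exists>W. open W \<and> p \<in> W \<and> finite {i\<in>J. W \<inter> T i \<noteq> {}}"
    using W(1,2) by auto
qed

lemma locally_finite_support:
  "locally_finite_family I (\<lambda>i. {p. f i p \<noteq> 0}) \<Longrightarrow> finite {i. i \<in> I \<and> f i p \<noteq> 0}"
proof -
  assume "locally_finite_family I (\<lambda>i. {p. f i p \<noteq> 0})"
  then obtain W where "p \<in> W" "finite {i\<in>I. W \<inter> {p. f i p \<noteq> 0} \<noteq> {}}"
    unfolding locally_finite_family_def by blast
  then show ?thesis
    by (rule_tac finite_subset) auto
qed

section \<open>Smooth functions with prescribed support\<close>

text \<open>In a chart the bump is \<open>exp (- 1 / (r\<^sup>2 - \<bar>z\<bar>\<^sup>2))\<close> on a small ball. Its extension
  by zero is smooth because the closed ball is compact, hence closed in the manifold, which is a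
  Hausdorff space.\<close>

lemma smooth_bump:
  assumes A: "smooth_atlas A" and "open G" "p \<in> G"
  obtains b where "smooth_fun A b" "\<And>q. 0 \<le> b q" "0 < b p" "\<And>q. b q \<noteq> 0 \<Longrightarrow> q \<in> G"
proof -
  obtain V x where c: "(V, x) \<in> A" and p: "p \<in> V"
    using chart_at[OF A] by blast
  note ch = is_chartD[OF smooth_atlasD(1)[OF A c]]
  have "open (x ` (V \<inter> G))" "x p \<in> x ` (V \<inter> G)"
    using ch(6) assms p by auto
  then obtain r where r: "0 < r" "cball (x p) r \<subseteq> x ` (V \<inter> G)"
    using open_contains_cball by blast
  define K where "K = inv_into V x ` cball (x p) r"
  have "compact K" unfolding K_def
    by (rule compact_continuous_image[OF continuous_on_subset[OF ch(4)]]) (use r in auto)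
  then have K: "closed K" by (rule compact_imp_closed)
  have "K \<subseteq> V \<inter> G"
    unfolding K_def using r ch(5) by (force simp: subset_iff image_iff)
  define s where "s z = r * r + - 1 * ((z + - x p) \<bullet> (z + - x p))" for z
  have s: "smooth_on T s" if "open T" for T
    unfolding s_def
    by (intro smooth_on_add smooth_on_mult smooth_on_inner smooth_on_const smooth_on_ident that)
  define b where "b q = (if q \<in> V then flat 0 (s (x q)) else 0)" for q
  have supp: "q \<in> K" if "b q \<noteq> 0" for q
  proof -
    have q: "q \<in> V" "0 < s (x q)"
      using that flat_pos_iff[of 0 "s (x q)"] flat_nonneg[of 0 "s (x q)"]
      by (auto simp: b_def less_le split: if_splits)
    then have "norm (x q - x p) ^ 2 < r ^ 2"
      by (simp add: s_def power2_norm_eq_inner) (simp add: power2_eq_square)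
    then have "norm (x q - x p) < r"
      using r(1) by (meson power_less_imp_less_base less_imp_le)
    then have "x q \<in> cball (x p) r"
      by (simp add: dist_norm norm_minus_commute)
    then show ?thesis
      unfolding K_def using ch(5)[OF q(1)] by (metis image_eqI)
  qed
  have "smooth_fun A b"
  proof (rule smooth_fun_local[OF A])
    fix q
    show "\<exists>W. open W \<and> q \<in> W \<and> (\<forall>(U, y)\<in>A. smooth_on (y ` (U \<inter> W)) (b \<circ> inv_into U y))"
    proof (cases "q \<in> V")
      case True
      have "smooth_on (y ` (U \<inter> V)) (b \<circ> inv_into U y)" if d: "(U, y) \<in> A" for U y
      proof -
        note chU = is_chartD[OF smooth_atlasD(1)[OF A d]]
        have "smooth_on (y ` (U \<inter> V)) (\<lambda>z. s ((x \<circ> inv_into U y) z))"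
          by (rule smooth_on_compose[OF chU(6)[OF ch(1)] open_UNIV subset_UNIV
                smooth_atlasD(2)[OF A d c] s[OF open_UNIV]])
        then have "smooth_on (y ` (U \<inter> V)) (\<lambda>z. flat 0 (s ((x \<circ> inv_into U y) z)))"
          by (rule smooth_on_compose[OF chU(6)[OF ch(1)] open_UNIV subset_UNIV _ smooth_on_flat])
        then show ?thesis
          by (rule smooth_on_cong[OF chU(6)[OF ch(1)], rotated]) (auto simp: chU b_def)
      qed
      then show ?thesis using True ch(1) by (intro exI[of _ V]) auto
    next
      case False
      have "smooth_on (y ` (U \<inter> - K)) (b \<circ> inv_into U y)" if d: "(U, y) \<in> A" for U y
      proof -
        note chU = is_chartD[OF smooth_atlasD(1)[OF A d]]
        have "open (- K)" using K by auto
        show ?thesis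
          by (rule smooth_on_cong[OF chU(6)[OF \<open>open (- K)\<close>] _ smooth_on_const[of _ 0]])
            (use supp in \<open>force simp: chU\<close>)
      qed
      then show ?thesis using False K \<open>K \<subseteq> V \<inter> G\<close> by (intro exI[of _ "- K"]) auto
    qed
  qed
  moreover have "0 < b p"
    using p r(1) by (simp add: b_def s_def flat_pos_iff)
  moreover have "0 \<le> b q" for q
    by (simp add: b_def flat_nonneg)
  ultimately show thesis
    using that[of b] supp \<open>K \<subseteq> V \<inter> G\<close> by blast
qed

text \<open>Countably many bumps \<open>b\<^sub>0, b\<^sub>1, \<dots>\<close>, each supported in \<open>U\<close> or off \<open>C\<close>, are positive
  somewhere at every point. Their supports need not be locally finite, so \<open>b\<^sub>k\<close> is multiplied by
  \<open>\<Prod>j<k. flat 0 (1 - k b\<^sub>j)\<close>: at a point where \<open>b\<^sub>m\<close> is positive, and so on a neighbourhood, this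
  factor vanishes for all large \<open>k\<close>, whereas it is positive if \<open>k\<close> is the first index with
  \<open>b\<^sub>k > 0\<close> at that point. The required function is the sum of the products whose bump is
  supported in \<open>U\<close>; at a point of \<open>C\<close> the first positive bump is one of these.\<close>

lemma smooth_support_function:
  fixes A :: "('m::{t2_space, second_countable_topology}, 'e::euclidean_space) chart set"
  assumes A: "smooth_atlas A" and C: "closed C" and U: "open U" "C \<subseteq> U"
  obtains \<psi> where "smooth_fun A \<psi>" "\<And>p. 0 \<le> \<psi> p" "\<And>p. p \<in> C \<Longrightarrow> 0 < \<psi> p"
    "\<And>p. \<psi> p \<noteq> 0 \<Longrightarrow> p \<in> U"
proof -
  define B where "B = {b. smooth_fun A b \<and> (\<forall>q. 0 \<le> b q) \<and>
    ((\<forall>q. b q \<noteq> 0 \<longrightarrow> q \<in> U) \<or> (\<forall>q. b q \<noteq> 0 \<longrightarrow> q \<notin> C))}"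
  have open_pos: "open {q. t < b q}" if "smooth_fun A b" for b t
    using smooth_fun_continuous[OF A that] by (intro open_Collect_less) auto
  have "\<exists>b\<in>B. 0 < b p" for p
  proof (cases "p \<in> C")
    case True
    then obtain b where "smooth_fun A b" "\<And>q. 0 \<le> b q" "0 < b p" "\<And>q. b q \<noteq> 0 \<Longrightarrow> q \<in> U"
      using smooth_bump[OF A U(1)] U(2) by blast
    then show ?thesis by (auto simp: B_def)
  next
    case False
    then obtain b where "smooth_fun A b" "\<And>q. 0 \<le> b q" "0 < b p" "\<And>q. b q \<noteq> 0 \<Longrightarrow> q \<in> - C"
      using smooth_bump[OF A, of "- C" p] C by auto
    then show ?thesis by (auto simp: B_def)
  qed
  then have cover: "(\<Union>b\<in>B. {q. 0 < b q}) = UNIV" by auto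
  have "\<And>S. S \<in> (\<lambda>b. {q. 0 < b q}) ` B \<Longrightarrow> open S"
    using open_pos by (auto simp: B_def)
  then obtain F where F: "F \<subseteq> (\<lambda>b. {q. 0 < b q}) ` B" "countable F" "\<Union>F = UNIV"
    using Lindelof[of "(\<lambda>b. {q. 0 < b q}) ` B"] cover by metis
  obtain B' where B': "countable B'" "B' \<subseteq> B" "F = (\<lambda>b. {q. 0 < b q}) ` B'"
    using countable_subset_image[of F "\<lambda>b. {q. 0 < b q}" B] F(1,2) by auto
  have "B' \<noteq> {}" using F(3) B'(3) by auto
  define b where "b = from_nat_into B'"
  have bB: "b k \<in> B" for k
    using from_nat_into[OF \<open>B' \<noteq> {}\<close>] B'(2) by (auto simp: b_def)
  have pos: "\<exists>k. 0 < b k p" for p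
  proof -
    have "p \<in> \<Union>F" using F(3) by simp
    then obtain b' where "b' \<in> B'" "0 < b' p" using B'(3) by auto
    then show ?thesis
      using from_nat_into_surj[OF B'(1)] by (metis b_def)
  qed
  have b: "smooth_fun A (b k)" "0 \<le> b k q" for k q
    using bB[of k] by (auto simp: B_def)
  define f where "f k q = b k q * (\<Prod>j<k. flat 0 (1 + - real k * b j q))" for k q
  have f: "smooth_fun A (f k)" for k
    unfolding f_def
    by (intro smooth_fun_mult[OF A] smooth_fun_prod[OF A]
          smooth_fun_compose_real[OF A _ open_UNIV subset_UNIV smooth_on_flat]
          smooth_fun_add[OF A] smooth_fun_const b)
  have f_nonneg: "0 \<le> f k q" for k q
    unfolding f_def by (intro mult_nonneg_nonneg b prod_nonneg flat_nonneg)
  define I where "I = {k. \<forall>q. b k q \<noteq> 0 \<longrightarrow> q \<in> U}"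
  have "locally_finite_family UNIV (\<lambda>k. {q. f k q \<noteq> 0})"
    unfolding locally_finite_family_def
  proof
    fix p
    obtain m where m: "0 < b m p" using pos by blast
    define W where "W = {q. b m p / 2 < b m q}"
    have "k \<le> max m (nat \<lceil>2 / b m p\<rceil>)" if "q \<in> W" "f k q \<noteq> 0" for k q
    proof (rule ccontr)
      assume "\<not> ?thesis"
      then have k: "m < k" "2 / b m p < real k" by linarith+
      have "1 < real k * (b m p / 2)" using k(2) m by (simp add: field_simps)
      also have "\<dots> \<le> real k * b m q" using that(1) by (intro mult_left_mono) (auto simp: W_def)
      finally have "flat 0 (1 + - real k * b m q) = 0" by (simp add: flat_def)
      then have "f k q = 0" using k(1) by (auto simp: f_def)
      then show False using that(2) by simp
    qed
    then have "{k\<in>UNIV. W \<inter> {q. f k q \<noteq> 0} \<noteq> {}} \<subseteq> {..max m (nat \<lceil>2 / b m p\<rceil>)}" by auto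
    then have "finite {k\<in>UNIV. W \<inter> {q. f k q \<noteq> 0} \<noteq> {}}" by (rule finite_subset) simp
    then show "\<exists>W. open W \<and> p \<in> W \<and> finite {k\<in>UNIV. W \<inter> {q. f k q \<noteq> 0} \<noteq> {}}"
      using m open_pos[OF b(1), of "b m p / 2" m] unfolding W_def[symmetric]
      by (intro exI[of _ W]) (simp add: W_def)
  qed
  then have lf: "locally_finite_family I (\<lambda>k. {q. f k q \<noteq> 0})"
    by (rule locally_finite_family_mono) auto
  define \<psi> where "\<psi> q = (\<Sum>k | k \<in> I \<and> f k q \<noteq> 0. f k q)" for q
  show thesis
  proof (rule that)
    show "smooth_fun A \<psi>"
      unfolding \<psi>_def using smooth_fun_locally_finite_sum[OF A f lf] .
    show "0 \<le> \<psi> p" for p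
      unfolding \<psi>_def by (intro sum_nonneg f_nonneg)
    show "p \<in> U" if nz: "\<psi> p \<noteq> 0" for p
    proof -
      obtain k where "k \<in> I" "f k p \<noteq> 0"
        using nz sum.not_neutral_contains_not_neutral unfolding \<psi>_def by blast
      then show ?thesis by (auto simp: I_def f_def)
    qed
    show "0 < \<psi> p" if "p \<in> C" for p
    proof -
      define m where "m = (LEAST k. 0 < b k p)"
      have m: "0 < b m p" unfolding m_def using pos by (rule LeastI_ex)
      have "b j p = 0" if "j < m" for j
        using not_less_Least[OF that[unfolded m_def]] b(2)[of j p] by simp
      then have "0 < f m p"
        using m by (auto simp: f_def flat_pos_iff intro!: mult_pos_pos prod_pos)
      moreover have "m \<in> I"
        using bB[of m] m that by (auto simp: B_def I_def)
      ultimately show ?thesis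
        unfolding \<psi>_def using locally_finite_support[OF lf, of p] f_nonneg
        by (intro sum_pos2[where i = m]) auto
    qed
  qed
qed


section \<open>Equivariant functions for groups with a fundamental region\<close>

lemma subgroup_BijGroupD:
  assumes "subgroup G (BijGroup UNIV)"
  shows "\<gamma> \<in> G \<Longrightarrow> bij \<gamma>"
    and "\<gamma> \<in> G \<Longrightarrow> \<delta> \<in> G \<Longrightarrow> \<gamma> \<circ> \<delta> \<in> G"
    and "\<gamma> \<in> G \<Longrightarrow> inv_into UNIV \<gamma> \<in> G"
proof -
  have Bij: "\<gamma> \<in> Bij UNIV" if "\<gamma> \<in> G" for \<gamma>
    using subgroup.subset[OF assms] that by (auto simp: BijGroup_def)
  show "\<gamma> \<in> G \<Longrightarrow> bij \<gamma>"
    using Bij by (auto simp: Bij_def)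
  show "\<gamma> \<circ> \<delta> \<in> G" if "\<gamma> \<in> G" "\<delta> \<in> G"
    using subgroup.m_closed[OF assms that] Bij[OF that(1)] Bij[OF that(2)]
    by (simp add: BijGroup_def compose_def comp_def restrict_def)
  show "inv_into UNIV \<gamma> \<in> G" if "\<gamma> \<in> G"
    using subgroup.m_inv_closed[OF assms that] inv_BijGroup[OF Bij[OF that]]
    by (simp add: restrict_def)
qed

text \<open>The sum over all \<open>\<gamma>\<close> in the group of \<open>\<kappa> \<gamma> \<cdot> (\<psi> \<circ> \<gamma>\<^sup>-\<^sup>1)\<close> transforms by \<open>\<kappa>\<close>,
  since translation by a group element only permutes its terms up to a factor. If \<open>\<psi>\<close> is positive
  on the closure of the region and supported in \<open>U\<close>, then the terms are supported in the locally
  finite family of the sets \<open>\<gamma> U\<close>, so the sum is smooth, and the translates of the closure cover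
  the manifold, so the sum is positive.\<close>

lemma smooth_equivariant_function:
  fixes A :: "('m::{t2_space, second_countable_topology}, 'e::euclidean_space) chart set"
    and \<kappa> :: "('m \<Rightarrow> 'm) \<Rightarrow> real"
  assumes A: "smooth_atlas A" and G: "subgroup G (BijGroup UNIV)"
    and smooth: "\<And>\<gamma> f. \<gamma> \<in> G \<Longrightarrow> smooth_fun A f \<Longrightarrow> smooth_fun A (f \<circ> \<gamma>)"
    and U: "open U" "closure R \<subseteq> U" "locally_finite_family G (\<lambda>\<gamma>. \<gamma> ` U)"
    and cover: "(\<Union>\<gamma>\<in>G. \<gamma> ` closure R) = UNIV"
    and \<kappa>_pos: "\<And>\<gamma>. \<gamma> \<in> G \<Longrightarrow> 0 < \<kappa> \<gamma>"
    and \<kappa>_mult: "\<And>\<gamma> \<delta>. \<gamma> \<in> G \<Longrightarrow> \<delta> \<in> G \<Longrightarrow> \<kappa> (\<gamma> \<circ> \<delta>) = \<kappa> \<gamma> * \<kappa> \<delta>"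
  obtains u where "smooth_fun A u" "\<And>p. 0 < u p" "\<And>\<gamma> p. \<gamma> \<in> G \<Longrightarrow> u (\<gamma> p) = \<kappa> \<gamma> * u p"
proof -
  note G = subgroup_BijGroupD[OF G]
  obtain \<psi> where \<psi>: "smooth_fun A \<psi>" "\<And>p. 0 \<le> \<psi> p" "\<And>p. p \<in> closure R \<Longrightarrow> 0 < \<psi> p"
    "\<And>p. \<psi> p \<noteq> 0 \<Longrightarrow> p \<in> U"
    using smooth_support_function[OF A closed_closure U(1,2)] by blast
  define T where "T \<gamma> p = \<kappa> \<gamma> * \<psi> (inv_into UNIV \<gamma> p)" for \<gamma> p
  have T_smooth: "smooth_fun A (T \<gamma>)" if "\<gamma> \<in> G" for \<gamma>
    using smooth_fun_mult[OF A smooth_fun_const smooth[OF G(3)[OF that] \<psi>(1)], of "\<kappa> \<gamma>"]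
    by (simp add: T_def[abs_def])
  have T_nonneg: "0 \<le> T \<gamma> p" if "\<gamma> \<in> G" for \<gamma> p
    using \<kappa>_pos[OF that] \<psi>(2) by (simp add: T_def)
  have lf: "locally_finite_family G (\<lambda>\<gamma>. {p. T \<gamma> p \<noteq> 0})"
  proof (rule locally_finite_family_mono[OF U(3) order_refl])
    fix \<gamma> assume "\<gamma> \<in> G"
    then have "p = \<gamma> (inv_into UNIV \<gamma> p)" for p
      using G(1) by (metis bij_inv_eq_iff)
    then show "{p. T \<gamma> p \<noteq> 0} \<subseteq> \<gamma> ` U"
      using \<psi>(4) by (auto simp: T_def)
  qed
  have equivariant: "T (\<delta> \<circ> \<gamma>) (\<delta> p) = \<kappa> \<delta> * T \<gamma> p" if "\<delta> \<in> G" "\<gamma> \<in> G" for \<delta> \<gamma> p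
  proof -
    have "inv_into UNIV (\<delta> \<circ> \<gamma>) (\<delta> p) = inv_into UNIV \<gamma> p"
      using G(1)[OF that(1)] G(1)[OF that(2)] by (simp add: o_inv_distrib bij_is_inj)
    then show ?thesis by (simp add: T_def \<kappa>_mult that)
  qed
  define u where "u p = (\<Sum>\<gamma> | \<gamma> \<in> G \<and> T \<gamma> p \<noteq> 0. T \<gamma> p)" for p
  show thesis
  proof (rule that)
    show "smooth_fun A u"
      unfolding u_def using smooth_fun_locally_finite_sum[OF A T_smooth lf] .
    show "0 < u p" for p
    proof -
      have "p \<in> (\<Union>\<gamma>\<in>G. \<gamma> ` closure R)" using cover by simp
      then obtain \<gamma> q where \<gamma>: "\<gamma> \<in> G" "q \<in> closure R" "p = \<gamma> q" by auto
      then have "0 < T \<gamma> p"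
        using \<psi>(3) \<kappa>_pos G(1) by (simp add: T_def bij_is_inj)
      then show ?thesis
        unfolding u_def using \<gamma>(1) locally_finite_support[OF lf, of p] T_nonneg
        by (intro sum_pos2[where i = \<gamma>]) auto
    qed
    show "u (\<delta> p) = \<kappa> \<delta> * u p" if \<delta>: "\<delta> \<in> G" for \<delta> p
    proof -
      have inv: "\<delta> \<circ> (inv_into UNIV \<delta> \<circ> \<gamma>) = \<gamma>" "inv_into UNIV \<delta> \<circ> (\<delta> \<circ> \<gamma>) = \<gamma>" for \<gamma>
        using G(1)[OF \<delta>] by (auto simp: fun_eq_iff bij_is_inj bij_is_surj surj_f_inv_f)
      have nz: "\<kappa> \<delta> \<noteq> 0" using \<kappa>_pos[OF \<delta>] by simp
      have "u (\<delta> p) = (\<Sum>\<gamma> | \<gamma> \<in> G \<and> T \<gamma> p \<noteq> 0. \<kappa> \<delta> * T \<gamma> p)"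
        unfolding u_def
      proof (rule sum.reindex_bij_witness[where i = "\<lambda>\<gamma>. \<delta> \<circ> \<gamma>" and j = "\<lambda>\<gamma>. inv_into UNIV \<delta> \<circ> \<gamma>"])
        fix \<gamma> assume \<gamma>: "\<gamma> \<in> {\<gamma>. \<gamma> \<in> G \<and> T \<gamma> (\<delta> p) \<noteq> 0}"
        then have "inv_into UNIV \<delta> \<circ> \<gamma> \<in> G" using G(2,3) \<delta> by auto
        from equivariant[OF \<delta> this, of p] \<gamma> this
        show "inv_into UNIV \<delta> \<circ> \<gamma> \<in> {\<gamma>. \<gamma> \<in> G \<and> T \<gamma> p \<noteq> 0}"
          and "\<kappa> \<delta> * T (inv_into UNIV \<delta> \<circ> \<gamma>) p = T \<gamma> (\<delta> p)"
          by (auto simp only: inv mem_Collect_eq)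
      qed (use G(2)[OF \<delta>] equivariant[OF \<delta>] nz in \<open>auto simp only: inv mem_Collect_eq mult_eq_0_iff\<close>)
      then show ?thesis
        by (simp add: u_def sum_distrib_left)
    qed
  qed
qed

section \<open>Homotheties and conformal changes of the metric\<close>

lemma pushforward_in_tangent_space:
  assumes smooth: "\<And>f. smooth_fun A f \<Longrightarrow> smooth_fun A (f \<circ> \<phi>)"
    and A: "smooth_atlas A" and v: "v \<in> tangent_space A p"
  shows "pushforward A \<phi> v \<in> tangent_space A (\<phi> p)"
proof -
  have lin: "smooth_fun A (\<lambda>q. a * f q + b * h q)" if "smooth_fun A f" "smooth_fun A h" for a b f h
    by (intro smooth_fun_add smooth_fun_mult smooth_fun_const A that)
  have mult: "smooth_fun A (\<lambda>q. f q * h q)" if "smooth_fun A f" "smooth_fun A h" for f h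
    by (intro smooth_fun_mult A that)
  show ?thesis
    using v smooth unfolding tangent_space_def pushforward_def
    by (simp add: lin mult comp_def)
qed

lemma pushforward_comp:
  assumes "\<And>f. smooth_fun A f \<Longrightarrow> smooth_fun A (f \<circ> \<gamma>)"
  shows "pushforward A (\<gamma> \<circ> \<delta>) v = pushforward A \<gamma> (pushforward A \<delta> v)"
  using assms by (auto simp: pushforward_def comp_assoc)

lemma pushforward_id: "v \<in> tangent_space A p \<Longrightarrow> pushforward A id v = v"
  by (auto simp: pushforward_def tangent_space_def)

text \<open>The smoothness of \<open>\<gamma>\<close> is expressed by its action on smooth functions, which makes it evidently
  stable under composition.\<close>

definition scales_metric ::
  "('m::topological_space, 'e::euclidean_space) chart set \<Rightarrow> 'm metric \<Rightarrow> ('m \<Rightarrow> 'm) \<Rightarrow> real \<Rightarrow> bool"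
  where "scales_metric A g \<gamma> a \<longleftrightarrow> 0 < a \<and> (\<forall>f. smooth_fun A f \<longrightarrow> smooth_fun A (f \<circ> \<gamma>)) \<and>
    eq_metric A (pullback A \<gamma> g) (\<lambda>p v w. a * g p v w)"

lemma scales_metric_comp:
  assumes A: "smooth_atlas A" and \<gamma>: "scales_metric A g \<gamma> a" and \<delta>: "scales_metric A g \<delta> b"
  shows "scales_metric A g (\<gamma> \<circ> \<delta>) (a * b)"
proof -
  have smooth: "smooth_fun A (f \<circ> \<gamma>)" "smooth_fun A (f \<circ> \<delta>)" if "smooth_fun A f" for f
    using \<gamma> \<delta> that by (auto simp: scales_metric_def)
  then have "smooth_fun A (f \<circ> (\<gamma> \<circ> \<delta>))" if "smooth_fun A f" for f
    using that by (metis comp_assoc)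
  then show ?thesis
    using \<gamma> \<delta> pushforward_in_tangent_space[OF smooth(2) A]
    by (simp add: scales_metric_def eq_metric_def pullback_def pushforward_comp[OF smooth(1)])
qed

lemma scales_metric_id: "scales_metric A g id 1"
  by (simp add: scales_metric_def eq_metric_def pullback_def pushforward_id)

lemma scales_metric_inverse:
  assumes A: "smooth_atlas A" and \<gamma>: "scales_metric A g \<gamma> a"
    and \<delta>: "\<gamma> \<circ> \<delta> = id" "\<And>f. smooth_fun A f \<Longrightarrow> smooth_fun A (f \<circ> \<delta>)"
  shows "scales_metric A g \<delta> (1 / a)"
proof -
  have a: "0 < a" and smooth: "\<And>f. smooth_fun A f \<Longrightarrow> smooth_fun A (f \<circ> \<gamma>)"
    using \<gamma> by (auto simp: scales_metric_def)
  have "g (\<delta> p) (pushforward A \<delta> v) (pushforward A \<delta> w) = 1 / a * g p v w"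
    if v: "v \<in> tangent_space A p" and w: "w \<in> tangent_space A p" for p v w
  proof -
    have cancel: "pushforward A \<gamma> (pushforward A \<delta> v) = v" "pushforward A \<gamma> (pushforward A \<delta> w) = w"
      by (simp_all add: pushforward_comp[OF smooth, symmetric] \<delta>(1) pushforward_id[OF v] pushforward_id[OF w])
    have "\<gamma> (\<delta> p) = p" using \<delta>(1) by (metis comp_apply id_apply)
    moreover have "g (\<gamma> (\<delta> p)) (pushforward A \<gamma> (pushforward A \<delta> v)) (pushforward A \<gamma> (pushforward A \<delta> w))
        = a * g (\<delta> p) (pushforward A \<delta> v) (pushforward A \<delta> w)"
      using \<gamma> pushforward_in_tangent_space[OF \<delta>(2) A v] pushforward_in_tangent_space[OF \<delta>(2) A w]
      by (simp add: scales_metric_def eq_metric_def pullback_def)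
    ultimately show ?thesis using a by (simp add: cancel)
  qed
  then show ?thesis
    using a \<delta>(2) by (simp add: scales_metric_def eq_metric_def pullback_def)
qed

lemma semi_riemannian_metric_rescale:
  assumes A: "smooth_atlas A" and g: "semi_riemannian_metric A g" and h: "smooth_fun A h"
  shows "semi_riemannian_metric A (rescale h g)"
proof -
  have "form_index T (rescale h g p) = form_index T (g p)" for T p
    by (simp add: form_index_def rescale_def mult_less_0_iff)
  moreover have "smooth_fun A (\<lambda>p. exp (2 * h p))"
    by (rule smooth_fun_compose_real[OF A _ open_UNIV subset_UNIV smooth_on_exp])
      (intro smooth_fun_mult A smooth_fun_const h)
  ultimately show ?thesis
    using g by (simp add: semi_riemannian_metric_def symmetric_bilinear_on_def
        nondegenerate_on_def rescale_def smooth_fun_mult[OF A] algebra_simps)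
qed

lemma cyclic_group_of_scales_metric:
  assumes A: "smooth_atlas A" and \<phi>: "diffeomorphism A \<phi>" "scales_metric A g \<phi> a"
    and "\<gamma> \<in> carrier (cyclic_group_of \<phi>)"
  shows "\<exists>a. scales_metric A g \<gamma> a"
proof -
  have carrier: "carrier (BijGroup UNIV) = (Bij UNIV :: ('a \<Rightarrow> 'a) set)"
    by (simp add: BijGroup_def)
  have "\<phi> \<in> Bij UNIV" using \<phi>(1) by (simp add: diffeomorphism_def Bij_def)
  then have "\<gamma> \<in> generate (BijGroup UNIV) {\<phi>}"
    using assms(4) by (simp add: cyclic_group_of_def carrier_subgroup_generated BijGroup_def)
  then show ?thesis
  proof induction
    case one
    have "\<one>\<^bsub>BijGroup UNIV\<^esub> = (id :: 'a \<Rightarrow> 'a)"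
      by (auto simp: BijGroup_def)
    then show ?case using scales_metric_id by metis
  next
    case (incl h)
    then show ?case using \<phi>(2) by auto
  next
    case (inv h)
    have "m_inv (BijGroup UNIV) \<phi> = inv_into UNIV \<phi>"
      using inv_BijGroup[OF \<open>\<phi> \<in> Bij UNIV\<close>] by (simp add: restrict_def)
    moreover have "\<phi> \<circ> inv_into UNIV \<phi> = id"
      using \<phi>(1) surj_iff bij_is_surj by (auto simp only: diffeomorphism_def)
    then have "scales_metric A g (inv_into UNIV \<phi>) (1 / a)"
      using \<phi> by (intro scales_metric_inverse[OF A \<phi>(2)] smooth_fun_compose_map[OF A])
        (auto simp: diffeomorphism_def)
    ultimately show ?case using inv by auto
  next
    case (eng h1 h2)
    have "h \<in> carrier (BijGroup UNIV)" if "h \<in> generate (BijGroup UNIV) {\<phi>}" for h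
      by (rule group.generate_in_carrier[OF group_BijGroup _ that])
        (simp add: carrier \<open>\<phi> \<in> Bij UNIV\<close>)
    from this[OF eng.hyps(1)] this[OF eng.hyps(2)]
    have "h1 \<otimes>\<^bsub>BijGroup UNIV\<^esub> h2 = h1 \<circ> h2"
      by (simp add: BijGroup_def compose_def comp_def restrict_def)
    then show ?case using eng.IH scales_metric_comp[OF A] by metis
  qed
qed

theorem proposition1p1:
  fixes A :: "('m::{t2_space, second_countable_topology}, 'e::euclidean_space) chart set"
    and g :: "'m metric"
    and \<phi> :: "'m \<Rightarrow> 'm"
  assumes "smooth_atlas A"
    and "semi_riemannian_metric A g"
    and "homothety A g \<phi>"
    and "\<not> isometry A g \<phi>"
    and "\<exists>R. strongly_locally_finite_region (cyclic_group_of \<phi>) (\<lambda>\<gamma>. \<gamma>) R"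
  shows "\<not> essential A g \<phi>"
proof -
  note A = assms(1)
  let ?G = "carrier (cyclic_group_of \<phi>)"
  obtain f where \<phi>: "diffeomorphism A \<phi>" and f: "smooth_fun A f" "f constant_on UNIV"
    "eq_metric A (pullback A \<phi> g) (rescale f g)"
    using assms(3) by (auto simp: homothety_def)
  obtain c where "f = (\<lambda>p. c)"
    using f(2) by (auto simp: constant_on_def)
  then have factor: "eq_metric A (pullback A \<phi> g) (\<lambda>p v w. exp (2 * c) * g p v w)"
    using f(3) by (simp add: rescale_def)
  then have scales: "scales_metric A g \<phi> (exp (2 * c))"
    using \<phi> smooth_fun_compose_map[OF A] by (auto simp: scales_metric_def diffeomorphism_def)
  have "\<phi> \<in> carrier (BijGroup UNIV)"
    using \<phi> by (simp add: diffeomorphism_def BijGroup_def Bij_def)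
  then have G: "subgroup ?G (BijGroup UNIV)" and "\<phi> \<in> ?G"
    by (simp_all add: cyclic_group_of_def carrier_subgroup_generated generate.incl
        group.generate_is_subgroup group_BijGroup)

  obtain a where a: "\<And>\<gamma>. \<gamma> \<in> ?G \<Longrightarrow> scales_metric A g \<gamma> (a \<gamma>)"
    using cyclic_group_of_scales_metric[OF A \<phi> scales] by metis
  \<comment> \<open>As \<open>\<phi>\<close> is not an isometry, \<open>g\<close> is not identically zero, and so the factors are unique.\<close>
  obtain p0 v0 w0 where nz: "v0 \<in> tangent_space A p0" "w0 \<in> tangent_space A p0" "g p0 v0 w0 \<noteq> 0"
    using assms(4) \<phi> factor by (fastforce simp: isometry_def eq_metric_def)
  have unique: "b = b'" if "scales_metric A g \<gamma> b" "scales_metric A g \<gamma> b'" for \<gamma> b b'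
    using that nz by (auto simp: scales_metric_def eq_metric_def)
  have a_pos: "0 < a \<gamma>" if "\<gamma> \<in> ?G" for \<gamma>
    using a[OF that] by (simp add: scales_metric_def)
  have a_mult: "a (\<gamma> \<circ> \<delta>) = a \<gamma> * a \<delta>" if "\<gamma> \<in> ?G" "\<delta> \<in> ?G" for \<gamma> \<delta>
    using unique a that subgroup_BijGroupD(2)[OF G] scales_metric_comp[OF A] by metis

  obtain R U where U: "open U" "closure R \<subseteq> U" "locally_finite_family ?G (\<lambda>\<gamma>. \<gamma> ` U)"
    and cover: "(\<Union>\<gamma>\<in>?G. \<gamma> ` closure R) = UNIV"
    using assms(5) by (auto simp: strongly_locally_finite_region_def fundamental_region_def)
  have smooth: "smooth_fun A (f \<circ> \<gamma>)" if "\<gamma> \<in> ?G" "smooth_fun A f" for \<gamma> f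
    using a[OF that(1)] that(2) by (simp add: scales_metric_def)
  obtain u where u: "smooth_fun A u" "\<And>p. 0 < u p"
    "\<And>\<gamma> p. \<gamma> \<in> ?G \<Longrightarrow> u (\<gamma> p) = 1 / a \<gamma> * u p"
    by (rule smooth_equivariant_function[OF A G smooth U cover, where \<kappa> = "\<lambda>\<gamma>. 1 / a \<gamma>"])
      (simp_all add: a_pos a_mult)
  have u_\<phi>: "u (\<phi> p) * exp (2 * c) = u p" for p
    using u(3)[OF \<open>\<phi> \<in> ?G\<close>] unique[OF a[OF \<open>\<phi> \<in> ?G\<close>] scales] by simp

  define h where "h p = 1 / 2 * ln (u p)" for p
  have exp_h: "exp (2 * h p) = u p" for p
    using u(2) by (simp add: h_def)
  have h: "smooth_fun A h"
    unfolding h_def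
    by (intro smooth_fun_mult A smooth_fun_const smooth_fun_compose_real[OF A u(1) _ _ smooth_on_ln])
      (use u(2) in auto)
  have "isometry A (rescale h g) \<phi>"
    unfolding isometry_def eq_metric_def
  proof (intro conjI \<phi> allI ballI)
    fix p v w assume "v \<in> tangent_space A p" "w \<in> tangent_space A p"
    then have "pullback A \<phi> (rescale h g) p v w = u (\<phi> p) * (exp (2 * c) * g p v w)"
      using factor by (simp add: pullback_def rescale_def exp_h eq_metric_def)
    then show "pullback A \<phi> (rescale h g) p v w = rescale h g p v w"
      by (simp add: rescale_def exp_h flip: u_\<phi>[of p])
  qed
  moreover have "conformally_equivalent A g (rescale h g)"
    using h by (auto simp: conformally_equivalent_def eq_metric_def)
  moreover have "semi_riemannian_metric A (rescale h g)"
    using semi_riemannian_metric_rescale[OF A assms(2) h] .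
  ultimately show ?thesis
    by (auto simp: essential_def inessential_def)
qed

end
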